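(* Let $P$ be a weakly ranked, finite, bounded poset of weak rank $n$, and let $h(P)=(h_0,h_1,\ldots,h_{n-1})$ be the sequence of coefficients of its Chow polynomial $H_P(t)=\sum_{i=0}^{n-1}h_it^i$. Then $h(P)$ is an $\operatorname{SI}$-sequence.
   Context: A weak rank function on a poset $P$ is a function $\rho:P\times P\to\mathbb{N}$, $(x,y)\mapsto\rho_{x,y}$, such that $\rho_{x,y}>0$ if and only if $x<y$, and $\rho_{x,y}=\rho_{x,z}+\rho_{z,y}$ for all $x\le z\le y$. A weakly ranked poset is a poset with a chosen weak rank function. $P$ is bounded if it has a least element $\hat 0$ and a greatest element $\hat 1$; write $\rho(x)=\rho_{\hat0,x}$, and the weak rank of $P$ is $\rho(P)=\rho(\hat1)$. The Chow polynomial of $P$ is $$H_P(t)=\sum_{s\ge 0}\ \sum_{\hat0=p_0<p_1<\cdots<p_s\le \hat1}\ \prod_{i=1}^{s}\frac{t\left(t^{\rho(p_i)-\rho(p_{i-1})-1}-1\right)}{t-1},$$ where the inner sum is over all chains starting at $\hat0$ (the empty product for $s=0$ equals $1$); it has degree $n-1$, nonnegative palindromic unimodal coefficients, and $h_0=1$. A monomial order ideal is a finite set of monomials (in finitely many variables) closed under taking divisors; its $h$-vector $(h_0,\ldots,h_e)$ records the number $h_d$ of its monomials of degree $d$. A sequence of nonnegative integers is an $O$-sequence if it is the $h$-vector of a monomial order ideal. For a palindromic unimodal sequence $h=(1,h_1,\ldots,h_e)$ its differential sequence is $\Delta h=(1,h_1-1,h_2-h_1,\ldots,h_{\lfloor e/2\rfloor}-h_{\lfloor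 e/2\rfloor-1})$. An $\operatorname{SI}$-sequence is a nonnegative palindromic sequence $h$ (with $h_0=1$) such that $\Delta h$ is an $O$-sequence. *)

theory Defs
  imports "HOL-Computational_Algebra.Polynomial" "HOL-Library.Multiset"
begin

text \<open>A poset is a carrier \<^term>\<open>P\<close> with a relation \<^term>\<open>r\<close> such that
  \<^term>\<open>partial_order_on P r\<close>; \<^term>\<open>(x, y) \<in> r\<close> means \<open>x \<le> y\<close>.\<close>

definition least_of :: "'a set \<Rightarrow> 'a rel \<Rightarrow> 'a \<Rightarrow> bool" where
  "least_of P r x \<longleftrightarrow> x \<in> P \<and> (\<forall>y\<in>P. (x, y) \<in> r)"

definition greatest_of :: "'a set \<Rightarrow> 'a rel \<Rightarrow> 'a \<Rightarrow> bool" where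
  "greatest_of P r x \<longleftrightarrow> x \<in> P \<and> (\<forall>y\<in>P. (y, x) \<in> r)"

definition weak_rank_function :: "'a set \<Rightarrow> 'a rel \<Rightarrow> ('a \<Rightarrow> 'a \<Rightarrow> nat) \<Rightarrow> bool" where
  "weak_rank_function P r \<rho> \<longleftrightarrow>
     (\<forall>x\<in>P. \<forall>y\<in>P. \<rho> x y > 0 \<longleftrightarrow> (x, y) \<in> r \<and> x \<noteq> y) \<and>
     (\<forall>x\<in>P. \<forall>y\<in>P. \<forall>z\<in>P. (x, z) \<in> r \<and> (z, y) \<in> r \<longrightarrow> \<rho> x y = \<rho> x z + \<rho> z y)"

text \<open>The factor \<open>t (t\<^bsup>k-1\<^esup> - 1) / (t - 1)\<close>, used for \<open>k \<ge> 1\<close>. The division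
  \<open>div\<close> of \<^typ>\<open>int poly\<close> is exact here; see \<open>chow_factor_mult\<close>.\<close>

definition chow_factor :: "nat \<Rightarrow> int poly" where
  "chow_factor k = (monom 1 1 * (monom 1 (k - 1) - 1)) div (monom 1 1 - 1)"

lemma chow_factor_mult:
  "chow_factor k * (monom 1 1 - 1) = monom 1 1 * (monom 1 (k - 1) - 1)"
proof -
  have "(monom 1 (k - 1) :: int poly) = monom 1 1 ^ (k - 1)"
    by (simp add: monom_power)
  then have "(monom 1 1 - 1 :: int poly) dvd monom 1 (k - 1) - 1"
    using power_diff_1_eq[of "monom 1 1 :: int poly" "k - 1"] by (metis dvd_triv_left)
  then have "(monom 1 1 - 1 :: int poly) dvd monom 1 1 * (monom 1 (k - 1) - 1)"
    by (rule dvd_mult)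
  then show ?thesis
    unfolding chow_factor_def by (rule dvd_div_mult_self)
qed

text \<open>A chain \<open>z = p\<^sub>0 < p\<^sub>1 < \<dots> < p\<^sub>s\<close> is the list \<open>[p\<^sub>0, \<dots>, p\<^sub>s]\<close>, so \<open>s\<close> is its
  length minus one. No upper bound is imposed: if \<^term>\<open>P\<close> has a greatest element, every
  \<open>p\<^sub>s\<close> is below it.\<close>

definition chains_from :: "'a set \<Rightarrow> 'a rel \<Rightarrow> 'a \<Rightarrow> 'a list set" where
  "chains_from P r z =
     {ps. ps \<noteq> [] \<and> set ps \<subseteq> P \<and> hd ps = z \<and> sorted_wrt (\<lambda>x y. (x, y) \<in> r \<and> x \<noteq> y) ps}"

lemma finite_chains_from:
  assumes "finite P"
  shows "finite (chains_from P r z)"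
proof -
  have "distinct ps" if "sorted_wrt (\<lambda>x y. (x, y) \<in> r \<and> x \<noteq> y) ps" for ps :: "'a list"
    using that by (induction ps) auto
  then have "chains_from P r z \<subseteq> {ps. set ps \<subseteq> P \<and> distinct ps}"
    by (auto simp: chains_from_def)
  then show ?thesis
    using finite_subset_distinct[OF assms] finite_subset by blast
qed

text \<open>The double sum over \<open>s\<close> and over chains of length \<open>s\<close> is the single sum over all chains;
  \<^term>\<open>z\<close> is the least element of the poset.\<close>

definition chow_poly :: "'a set \<Rightarrow> 'a rel \<Rightarrow> ('a \<Rightarrow> 'a \<Rightarrow> nat) \<Rightarrow> 'a \<Rightarrow> int poly" where
  "chow_poly P r \<rho> z =
     (\<Sum>ps\<in>chains_from P r z.
        \<Prod>i = 1..<length ps. chow_factor (\<rho> z (ps ! i) - \<rho> z (ps ! (i - 1))))"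

text \<open>A monomial in the variables \<open>x\<^sub>0, x\<^sub>1, \<dots>\<close> is a multiset of indices, so divisibility is
  \<open>\<subseteq>#\<close> and the degree is \<^const>\<open>size\<close>. A finite set of monomials involves only finitely many
  variables.\<close>

definition monomial_order_ideal :: "nat multiset set \<Rightarrow> bool" where
  "monomial_order_ideal M \<longleftrightarrow> finite M \<and> (\<forall>u\<in>M. \<forall>v. v \<subseteq># u \<longrightarrow> v \<in> M)"

text \<open>A sequence \<open>(h\<^sub>0, \<dots>, h\<^sub>e)\<close> is a list of length \<open>e + 1\<close>. Trailing zeros are allowed:
  \<open>e\<close> bounds the degrees of the monomials but need not be attained.\<close>

definition O_sequence :: "int list \<Rightarrow> bool" where
  "O_sequence h \<longleftrightarrow>
     (\<exists>M. monomial_order_ideal M \<and> (\<forall>u\<in>M. size u < length h) \<and>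
          (\<forall>d<length h. h ! d = int (card {u \<in> M. size u = d})))"

definition differential_seq :: "int list \<Rightarrow> int list" where
  "differential_seq h =
     map (\<lambda>i. if i = 0 then h ! 0 else h ! i - h ! (i - 1)) [0..<(length h - 1) div 2 + 1]"

text \<open>Unimodality, under which \<^const>\<open>differential_seq\<close> is usually considered, follows from
  the last two conditions, because an O-sequence is nonnegative.\<close>

definition SI_sequence :: "int list \<Rightarrow> bool" where
  "SI_sequence h \<longleftrightarrow>
     h \<noteq> [] \<and> h ! 0 = 1 \<and> (\<forall>c\<in>set h. c \<ge> 0) \<and> rev h = h \<and> O_sequence (differential_seq h)"

end

theory Submission
  imports Defs
begin

text \<open>Write \<open>[a] = 1 + t + \<dots> + t\<^bsup>a-1\<^esup>\<close> and let \<open>c\<^sub>y\<close> be the weak rank of the interval from \<open>y\<close>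
  to the top. Expanding the factors \<open>t [k - 1]\<close> of the Chow polynomial gives the
  Feichtner--Yuzvinsky monomials \<open>p\<^sub>1\<^bsup>m\<^sub>1\<^esup> \<dots> p\<^sub>s\<^bsup>m\<^sub>s\<^esup>\<close>, where \<open>p\<^sub>1 < \<dots> < p\<^sub>s\<close> and
  \<open>1 \<le> m\<^sub>i < \<rho>(p\<^sub>i) - \<rho>(p\<^sub>i\<^sub>-\<^sub>1)\<close>. Call such a monomial primitive if moreover
  \<open>m\<^sub>j + 2 (m\<^sub>j\<^sub>+\<^sub>1 + \<dots> + m\<^sub>s) \<le> c\<^sub>p\<close> with \<open>p = p\<^sub>j\<close>, for all \<open>j\<close>. The primitive monomials are the
  bottoms of the Greene--Kleitman symmetric chains, bracketed from the top of the poset downwards;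
  read in this direction all the conditions persist under passing to divisors, so they form an
  order ideal. Peeling off the smallest element of the support and using
  \<open>[a] [b] = \<Sum>\<^sub>j t\<^sup>j [a + b - 1 - 2 j]\<close>, one finds that the Chow polynomial is the sum of
  \<open>t\<^sup>d [n - 2 d]\<close> over the primitive monomials if \<open>n > 0\<close>, \<open>d\<close> being the degree. Hence its coefficients are
  palindromic, and their differences up to the middle count primitive monomials by degree.\<close>

section \<open>Geometric sums and Chow factors\<close>

definition geom_sum :: "'a::comm_ring_1 \<Rightarrow> nat \<Rightarrow> 'a" where
  "geom_sum x a = (\<Sum>i<a. x ^ i)"

lemma geom_sum_0 [simp]: "geom_sum x 0 = 0"
  by (simp add: geom_sum_def)

lemma geom_sum_Suc: "geom_sum x (Suc a) = geom_sum x a + x ^ a"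
  by (simp add: geom_sum_def)

lemma geom_sum_add: "geom_sum x (a + b) = geom_sum x a + x ^ a * geom_sum x b"
  by (induction b) (simp_all add: geom_sum_Suc algebra_simps power_add)

lemma geom_sum_Suc_shift: "geom_sum x (Suc a) = 1 + x * geom_sum x a"
  using geom_sum_add[of x 1 a] by (simp add: geom_sum_Suc)

text \<open>Since \<open>[a + 1] [b + 1] = [a + b + 1] + x [a] [b]\<close>, the induction peels off
  the summand \<open>j = 0\<close> and shifts the rest. No subtraction truncates for
  \<open>j < min a b\<close>.\<close>

lemma geom_sum_mult:
  "geom_sum x a * geom_sum x b = (\<Sum>j<min a b. x ^ j * geom_sum x (a + b - 1 - 2 * j))"
proof (induction a arbitrary: b)
  case 0
  then show ?case by simp
next
  case (Suc a)
  show ?case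
  proof (cases b)
    case 0
    then show ?thesis by simp
  next
    case (Suc b')
    have "geom_sum x (Suc a) * geom_sum x (Suc b')
        = geom_sum x (Suc b' + a) + x * (geom_sum x a * geom_sum x b')"
      unfolding geom_sum_add
      by (simp add: geom_sum_Suc_shift[of x a] algebra_simps)
        (simp add: geom_sum_Suc algebra_simps)
    also have "\<dots> = (\<Sum>j<min (Suc a) (Suc b'). x ^ j * geom_sum x (Suc a + Suc b' - 1 - 2 * j))"
      by (simp add: Suc.IH sum.lessThan_Suc_shift sum_distrib_left mult.assoc
            add.commute del: sum.lessThan_Suc)
    finally show ?thesis using Suc by simp
  qed
qed

lemma chow_factor_eq: "chow_factor k = monom 1 1 * geom_sum (monom 1 1) (k - 1)"
proof -
  let ?X = "monom 1 1 :: int poly"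
  have "coeff (?X - 1) 1 \<noteq> 0"
    by (simp add: coeff_1)
  then have nz: "?X - 1 \<noteq> 0"
    by (metis coeff_0)
  have "monom 1 (k - 1) - 1 = (?X - 1) * geom_sum ?X (k - 1)"
    using power_diff_1_eq[of ?X "k - 1"] by (simp only: geom_sum_def monom_power power_one mult_1)
  then have "chow_factor k * (?X - 1) = (?X * geom_sum ?X (k - 1)) * (?X - 1)"
    unfolding chow_factor_mult by (simp only: mult_ac)
  then show ?thesis
    using nz by (simp only: mult_cancel_right) simp
qed

lemma coeff_power_mult_geom_sum:
  "coeff (monom 1 1 ^ d * geom_sum (monom 1 1) a :: int poly) i
     = (if d \<le> i \<and> i < d + a then 1 else 0)"
proof -
  have "coeff (monom 1 1 ^ d * geom_sum (monom 1 1) a :: int poly) i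
      = (\<Sum>j<a. if j = i - d then if d \<le> i then 1 else 0 else 0)"
    unfolding geom_sum_def sum_distrib_left coeff_sum
    by (intro sum.cong refl) (auto simp: monom_power mult_monom simp flip: power_add)
  then show ?thesis by auto
qed

section \<open>From order ideals to SI-sequences\<close>

text \<open>Only finitely many variables occur in \<open>M\<close>; numbering them injectively
  preserves degrees and carries divisors to divisors.\<close>

lemma O_sequenceI:
  fixes M :: "'a multiset set"
  assumes "finite M"
    and closed: "\<And>u v. u \<in> M \<Longrightarrow> v \<subseteq># u \<Longrightarrow> v \<in> M"
    and size: "\<And>u. u \<in> M \<Longrightarrow> size u < length h"
    and h: "\<And>d. d < length h \<Longrightarrow> h ! d = int (card {u \<in> M. size u = d})"
  shows "O_sequence h"
proof -
  define A where "A = (\<Union>u\<in>M. set_mset u)"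
  have "finite A"
    using \<open>finite M\<close> by (simp add: A_def)
  then obtain g :: "'a \<Rightarrow> nat" where g: "inj_on g A"
    using finite_imp_inj_to_nat_seg by blast
  have inv: "image_mset (inv_into A g) (image_mset g u) = u" if "u \<in> M" for u
  proof -
    have "set_mset u \<subseteq> A"
      using that by (auto simp: A_def)
    then have "image_mset (inv_into A g \<circ> g) u = image_mset id u"
      using g by (intro image_mset_cong) auto
    then show ?thesis by (simp add: multiset.map_comp)
  qed
  then have inj: "inj_on (image_mset g) M"
    by (metis inj_onI)
  have "v \<in> image_mset g ` M" if "u \<in> M" "v \<subseteq># image_mset g u" for u v
  proof -
    let ?w = "image_mset (inv_into A g) v"
    have "?w \<subseteq># u"
      using that inv image_mset_subseteq_mono by metis
    then have "?w \<in> M"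
      using closed that by blast
    moreover have "v = image_mset g ?w"
    proof -
      have "x \<in> g ` A" if "x \<in># v" for x
        using \<open>u \<in> M\<close> set_mset_mono[OF \<open>v \<subseteq># image_mset g u\<close>] that
        unfolding A_def set_image_mset by blast
      then have "image_mset (g \<circ> inv_into A g) v = image_mset id v"
        by (intro image_mset_cong) (auto simp: f_inv_into_f)
      then show ?thesis by (simp add: multiset.map_comp)
    qed
    ultimately show ?thesis by blast
  qed
  then have "monomial_order_ideal (image_mset g ` M)"
    using \<open>finite M\<close> by (auto simp: monomial_order_ideal_def)
  moreover have "card {u \<in> image_mset g ` M. size u = d} = card {u \<in> M. size u = d}" for d
  proof -
    have "{u \<in> image_mset g ` M. size u = d} = image_mset g ` {u \<in> M. size u = d}"
      by auto
    then show ?thesis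
      using inj by (simp add: card_image inj_on_subset)
  qed
  ultimately show ?thesis
    using size h unfolding O_sequence_def by (intro exI[of _ "image_mset g ` M"]) auto
qed

text \<open>A monomial of degree \<open>d\<close> contributes 1 to the coefficients from
  \<open>d\<close> to \<open>e - d\<close>, an interval symmetric about \<open>e / 2\<close>. Up to
  the middle its upper end imposes nothing, so successive differences count monomials by exact
  degree.\<close>

lemma SI_sequence_coeffsI:
  fixes M :: "'a multiset set" and p :: "int poly"
  assumes "finite M" and "{#} \<in> M"
    and closed: "\<And>u v. u \<in> M \<Longrightarrow> v \<subseteq># u \<Longrightarrow> v \<in> M"
    and size: "\<And>u. u \<in> M \<Longrightarrow> 2 * size u \<le> e"
    and coeff: "\<And>i. coeff p i = int (card {u \<in> M. size u \<le> i \<and> i + size u \<le> e})"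
  shows "degree p = e \<and> SI_sequence (coeffs p)"
proof -
  \<comment> \<open>Only the monomial 1 reaches the extreme positions, which fixes both the degree
    and the constant coefficient.\<close>
  have ends: "{u \<in> M. size u \<le> 0 \<and> 0 + size u \<le> e} = {{#}}"
    "{u \<in> M. size u \<le> e \<and> e + size u \<le> e} = {{#}}"
    using \<open>{#} \<in> M\<close> by auto
  have c0: "coeff p 0 = 1" and ce: "coeff p e = 1"
    unfolding coeff ends by simp_all
  have "coeff p i = 0" if "e < i" for i
    using that by (simp add: coeff)
  then have deg: "degree p = e"
    by (metis ce degree_le le_antisym le_degree zero_neq_one)
  have "p \<noteq> 0"
    using c0 by auto
  then have len: "length (coeffs p) = Suc e"
    using deg by (simp add: length_coeffs_degree)
  have nth: "coeffs p ! i = coeff p i" if "i \<le> e" for i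
    using that deg \<open>p \<noteq> 0\<close> by (simp add: coeffs_nth)
  have sym: "coeff p (e - i) = coeff p i" if "i \<le> e" for i
  proof -
    have "{u \<in> M. size u \<le> e - i \<and> e - i + size u \<le> e} = {u \<in> M. size u \<le> i \<and> i + size u \<le> e}"
      using that by auto
    then show ?thesis by (simp add: coeff)
  qed
  have low: "coeff p i = int (card {u \<in> M. size u \<le> i})" if "2 * i \<le> e" for i
  proof -
    have "{u \<in> M. size u \<le> i \<and> i + size u \<le> e} = {u \<in> M. size u \<le> i}"
      using that by auto
    then show ?thesis by (simp add: coeff)
  qed
  have diff: "coeff p (Suc i) - coeff p i = int (card {u \<in> M. size u = Suc i})"
    if "2 * Suc i \<le> e" for i
  proof -
    have "{u \<in> M. size u \<le> Suc i} = {u \<in> M. size u \<le> i} \<union> {u \<in> M. size u = Suc i}"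
      by auto
    then have "card {u \<in> M. size u \<le> Suc i} = card {u \<in> M. size u \<le> i} + card {u \<in> M. size u = Suc i}"
      using \<open>finite M\<close> by (simp add: card_Un_disjoint disjoint_iff)
    then show ?thesis
      using that by (simp add: low)
  qed
  have "O_sequence (differential_seq (coeffs p))"
  proof (rule O_sequenceI[OF \<open>finite M\<close> closed])
    show "size u < length (differential_seq (coeffs p))" if "u \<in> M" for u
      using size[OF that] by (simp add: differential_seq_def len)
    fix d assume "d < length (differential_seq (coeffs p))"
    then have d: "2 * d \<le> e"
      by (auto simp: differential_seq_def len)
    show "differential_seq (coeffs p) ! d = int (card {u \<in> M. size u = d})"
    proof (cases d)
      case 0
      have "{u \<in> M. size u = 0} = {{#}}"
        using \<open>{#} \<in> M\<close> by auto
      then show ?thesis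
        using 0 by (simp add: differential_seq_def nth c0 nth_append upt_rec)
    next
      case (Suc i)
      then have "d < (length (coeffs p) - 1) div 2 + 1"
        using d len by auto
      then have "differential_seq (coeffs p) ! d = coeff p d - coeff p i"
        using Suc d by (simp add: differential_seq_def nth del: upt_Suc)
      then show ?thesis
        using diff Suc d by simp
    qed
  qed auto
  moreover have "rev (coeffs p) = coeffs p"
    by (rule nth_equalityI) (auto simp: rev_nth len nth sym)
  moreover have "\<forall>c\<in>set (coeffs p). c \<ge> 0"
    by (auto simp: in_set_conv_nth len nth less_Suc_eq_le coeff)
  ultimately show ?thesis
    using deg c0 \<open>p \<noteq> 0\<close> nth[of 0] by (simp add: SI_sequence_def)
qed

section \<open>Ranks and coranks in a bounded poset\<close>

locale weakly_ranked_poset =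
  fixes P :: "'a set" and r :: "'a rel" and \<rho> :: "'a \<Rightarrow> 'a \<Rightarrow> nat" and hat0 hat1 :: 'a
  assumes finite_P: "finite P"
    and order: "partial_order_on P r"
    and least: "least_of P r hat0"
    and greatest: "greatest_of P r hat1"
    and weak_rank: "weak_rank_function P r \<rho>"
begin

definition above :: "'a \<Rightarrow> 'a set" where
  "above x = {y \<in> P. (x, y) \<in> r \<and> x \<noteq> y}"

abbreviation corank :: "'a \<Rightarrow> nat" where
  "corank x \<equiv> \<rho> x hat1"

lemma finite_above [simp]: "finite (above x)"
  using finite_P by (simp add: above_def)

lemma above_P: "y \<in> above x \<Longrightarrow> y \<in> P"
  by (simp add: above_def)

lemma above_irrefl [simp]: "x \<notin> above x"
  by (simp add: above_def)

lemma above_trans: "y \<in> above x \<Longrightarrow> z \<in> above y \<Longrightarrow> z \<in> above x"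
  using order unfolding above_def partial_order_on_def preorder_on_def
  by (auto dest: transD antisymD)

lemma hat0_P: "hat0 \<in> P" and hat1_P: "hat1 \<in> P"
  using least greatest by (auto simp: least_of_def greatest_of_def)

lemma rank_pos: "x \<in> P \<Longrightarrow> y \<in> above x \<Longrightarrow> \<rho> x y > 0"
  using weak_rank by (auto simp: above_def weak_rank_function_def)

lemma rank_add:
  "x \<in> P \<Longrightarrow> y \<in> P \<Longrightarrow> z \<in> P \<Longrightarrow> (x, z) \<in> r \<Longrightarrow> (z, y) \<in> r \<Longrightarrow> \<rho> x y = \<rho> x z + \<rho> z y"
  using weak_rank by (auto simp: weak_rank_function_def)

lemma corank_above: "x \<in> P \<Longrightarrow> y \<in> above x \<Longrightarrow> corank x = \<rho> x y + corank y"
  using greatest by (intro rank_add) (auto simp: above_def greatest_of_def)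

lemma corank_hat1 [simp]: "corank hat1 = 0"
  using weak_rank hat1_P by (auto simp: weak_rank_function_def)

lemma hat1_above: "x \<in> P \<Longrightarrow> x \<noteq> hat1 \<Longrightarrow> hat1 \<in> above x"
  using greatest by (auto simp: above_def greatest_of_def)

lemma corank_eq_0_iff: "x \<in> P \<Longrightarrow> corank x = 0 \<longleftrightarrow> x = hat1"
  using hat1_above rank_pos by (metis corank_hat1 less_irrefl)

lemma above_hat1: "above hat1 = {}"
  using corank_above[OF hat1_P] rank_pos[OF hat1_P] by fastforce

text \<open>Factors of the Chow polynomial are written with ranks measured from \<open>hat0\<close>;
  this makes them depend on a single step of the chain only.\<close>

lemma rank_diff: "x \<in> P \<Longrightarrow> y \<in> above x \<Longrightarrow> \<rho> hat0 y - \<rho> hat0 x = \<rho> x y"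
  using rank_add[of hat0 y x] hat0_P least by (auto simp: above_def least_of_def)

section \<open>Recursion for the Chow polynomial\<close>

lemma chains_from_rec:
  assumes "x \<in> P"
  shows "chains_from P r x = insert [x] (\<Union>y\<in>above x. Cons x ` chains_from P r y)"
proof (intro equalityI subsetI)
  fix ps assume ps: "ps \<in> chains_from P r x"
  then obtain qs where qs: "ps = x # qs"
    by (cases ps) (auto simp: chains_from_def)
  show "ps \<in> insert [x] (\<Union>y\<in>above x. Cons x ` chains_from P r y)"
  proof (cases qs)
    case Nil
    then show ?thesis using qs by simp
  next
    case (Cons y qs')
    then have "y \<in> above x" "qs \<in> chains_from P r y"
      using ps qs by (auto simp: chains_from_def above_def)
    then show ?thesis using qs by blast
  qed
next
  fix ps assume "ps \<in> insert [x] (\<Union>y\<in>above x. Cons x ` chains_from P r y)"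
  then consider "ps = [x]" | y qs where "y \<in> above x" "qs \<in> chains_from P r y" "ps = x # qs"
    by blast
  then show "ps \<in> chains_from P r x"
  proof cases
    case 1
    then show ?thesis using assms by (simp add: chains_from_def)
  next
    case 2
    then obtain qs' where qs': "qs = y # qs'"
      by (cases qs) (auto simp: chains_from_def)
    have "z \<in> above x" if "z \<in> set qs" for z
      using that 2 qs' above_trans[OF 2(1), of z] by (auto simp: chains_from_def above_def)
    then show ?thesis
      using 2 assms by (auto simp: chains_from_def above_def)
  qed
qed

text \<open>The Chow polynomial of the interval from \<open>x\<close> to \<open>hat1\<close>. Ranks
  are still measured from \<open>hat0\<close>, so that at \<open>hat0\<close> it is literally
  \<open>chow_poly\<close>.\<close>

definition upper_chow :: "'a \<Rightarrow> int poly" where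
  "upper_chow x = (\<Sum>ps\<in>chains_from P r x.
     \<Prod>i = 1..<length ps. chow_factor (\<rho> hat0 (ps ! i) - \<rho> hat0 (ps ! (i - 1))))"

lemma upper_chow_hat0: "upper_chow hat0 = chow_poly P r \<rho> hat0"
  by (simp add: upper_chow_def chow_poly_def)

text \<open>Chains are grouped by their second element \<open>y\<close>: the first factor depends on
  \<open>x\<close> and \<open>y\<close> only, and the rest is a chain from \<open>y\<close>.\<close>

lemma upper_chow_rec:
  assumes "x \<in> P"
  shows "upper_chow x = 1 + (\<Sum>y\<in>above x. chow_factor (\<rho> x y) * upper_chow y)"
proof -
  let ?W = "\<lambda>ps. \<Prod>i = 1..<length ps. chow_factor (\<rho> hat0 (ps ! i) - \<rho> hat0 (ps ! (i - 1)))"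
  have fin: "finite (chains_from P r y)" for y
    using finite_P by (rule finite_chains_from)
  have W: "?W (x # qs) = chow_factor (\<rho> x y) * ?W qs"
    if "y \<in> above x" "qs \<in> chains_from P r y" for y qs
  proof -
    from that(2) obtain qs' where qs': "qs = y # qs'"
      by (cases qs) (auto simp: chains_from_def)
    have "?W (x # qs)
        = (\<Prod>i<length qs. chow_factor (\<rho> hat0 ((x # qs) ! Suc i) - \<rho> hat0 ((x # qs) ! i)))"
      using prod.shift_bounds_Suc_ivl[of
          "\<lambda>i. chow_factor (\<rho> hat0 ((x # qs) ! i) - \<rho> hat0 ((x # qs) ! (i - 1)))" 0 "length qs"]
      by (simp add: atLeast0LessThan)
    also have "\<dots> = chow_factor (\<rho> x y) *
        (\<Prod>i<length qs'. chow_factor (\<rho> hat0 (qs ! Suc i) - \<rho> hat0 (qs ! i)))"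
      using rank_diff[OF assms that(1)]
      by (simp add: qs' prod.lessThan_Suc_shift del: prod.lessThan_Suc)
    also have "(\<Prod>i<length qs'. chow_factor (\<rho> hat0 (qs ! Suc i) - \<rho> hat0 (qs ! i))) = ?W qs"
      using prod.shift_bounds_Suc_ivl[of
          "\<lambda>i. chow_factor (\<rho> hat0 (qs ! i) - \<rho> hat0 (qs ! (i - 1)))" 0 "length qs'"]
      by (simp add: qs' atLeast0LessThan)
    finally show ?thesis .
  qed
  have "upper_chow x = ?W [x] + (\<Sum>ps\<in>(\<Union>y\<in>above x. Cons x ` chains_from P r y). ?W ps)"
    unfolding upper_chow_def chains_from_rec[OF assms]
    by (rule sum.insert) (simp_all add: fin, auto simp: chains_from_def)
  also have "(\<Sum>ps\<in>(\<Union>y\<in>above x. Cons x ` chains_from P r y). ?W ps)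
      = (\<Sum>y\<in>above x. \<Sum>ps\<in>Cons x ` chains_from P r y. ?W ps)"
    by (rule sum.UNION_disjoint) (simp_all add: fin, auto simp: chains_from_def)
  also have "\<dots> = (\<Sum>y\<in>above x. chow_factor (\<rho> x y) * upper_chow y)"
  proof (rule sum.cong[OF refl])
    fix y assume y: "y \<in> above x"
    have "(\<Sum>ps\<in>Cons x ` chains_from P r y. ?W ps) = (\<Sum>qs\<in>chains_from P r y. ?W (x # qs))"
      by (subst sum.reindex) simp_all
    also have "\<dots> = (\<Sum>qs\<in>chains_from P r y. chow_factor (\<rho> x y) * ?W qs)"
      by (intro sum.cong refl W y)
    finally show "(\<Sum>ps\<in>Cons x ` chains_from P r y. ?W ps) = chow_factor (\<rho> x y) * upper_chow y"
      by (simp only: upper_chow_def sum_distrib_left)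
  qed
  finally show ?thesis by simp
qed

section \<open>The order ideal of primitive monomials\<close>

text \<open>These are the primitive monomials of the interval from \<open>x\<close> to
  \<open>hat1\<close>, with \<open>x\<close> as \<open>p_0\<close>. In \<open>add\<close>,
  \<open>y\<close> is the new smallest support element; the conditions on \<open>v\<close> have
  \<open>y\<close> as their predecessor already, so only those at \<open>y\<close> are new.\<close>

inductive primitive :: "'a \<Rightarrow> 'a multiset \<Rightarrow> bool" where
  empty: "primitive x {#}"
| add: "\<lbrakk>y \<in> above x; primitive y v; 1 \<le> m; m < \<rho> x y; m + 2 * size v \<le> corank y\<rbrakk>
    \<Longrightarrow> primitive x (v + replicate_mset m y)"

lemma primitive_above: "primitive x u \<Longrightarrow> y \<in># u \<Longrightarrow> y \<in> above x"
  by (induction rule: primitive.induct) (auto dest: above_trans split: if_splits)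

text \<open>In \<open>add\<close>, the bounds \<open>m \<le> \<rho> x y - 1\<close> and
  \<open>m + 2 * size v \<le> corank y\<close> add up to the claim.\<close>

lemma primitive_size:
  "primitive x u \<Longrightarrow> x \<in> P \<Longrightarrow> 2 * size u \<le> corank x - 1"
  by (induction rule: primitive.induct) (auto simp: corank_above)

text \<open>Lowering the base point only relaxes the rank bound on the exponent of the smallest
  support element.\<close>

lemma primitive_mono:
  assumes "x \<in> P" "y \<in> above x" "primitive y u"
  shows "primitive x u"
  using assms(3)
proof cases
  case empty
  then show ?thesis by (simp add: primitive.empty)
next
  case (add z v m)
  have "\<rho> x z = \<rho> x y + \<rho> y z"
    using assms add by (intro rank_add) (auto simp: above_def)
  then show ?thesis
    using add assms above_trans[of y x z] by (auto intro: primitive.add)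
qed

text \<open>A divisor is \<open>v' y^k\<close> with \<open>v'\<close> dividing \<open>v\<close> and
  \<open>k \<le> m\<close>, and all upper bounds survive shrinking. If \<open>k = 0\<close>, then
  \<open>y\<close> leaves the support and \<open>primitive_mono\<close> moves the base point of
  \<open>v'\<close> from \<open>y\<close> down to \<open>x\<close>.\<close>

lemma primitive_subset:
  "primitive x u \<Longrightarrow> x \<in> P \<Longrightarrow> w \<subseteq># u \<Longrightarrow> primitive x w"
proof (induction arbitrary: w rule: primitive.induct)
  case (empty x)
  then show ?case by (simp add: primitive.empty)
next
  case (add y x v m)
  define k where "k = count w y"
  define v' where "v' = w - replicate_mset k y"
  have w: "w = v' + replicate_mset k y"
    by (simp add: v'_def k_def subset_mset.diff_add count_le_replicate_mset_subset_eq[symmetric])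
  \<comment> \<open>The support of \<open>v\<close> lies strictly above \<open>y\<close>, so the
    whole product contains \<open>y\<close> exactly \<open>m\<close> times.\<close>
  have "y \<notin># v"
    using add.hyps(2) primitive_above by fastforce
  have "k \<le> m"
    using mset_subset_eq_count[OF add.prems(2), of y] \<open>y \<notin># v\<close>
    by (simp add: k_def not_in_iff)
  have "v' \<subseteq># v"
  proof (rule mset_subset_eqI)
    fix a show "count v' a \<le> count v a"
      using mset_subset_eq_count[OF add.prems(2), of a]
      by (cases "a = y") (auto simp: v'_def k_def)
  qed
  then have v': "primitive y v'" "size v' \<le> size v"
    using add by (auto intro: size_mset_mono dest: above_P)
  show ?case
  proof (cases "k = 0")
    case True
    then show ?thesis
      using v' add w by (auto intro: primitive_mono)
  next
    case False
    then show ?thesis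
      unfolding w using add v' \<open>k \<le> m\<close> by (intro primitive.add) auto
  qed
qed

text \<open>The two upper bounds on \<open>m\<close> merge into a minimum of the shape that limits
  the sum in \<open>geom_sum_mult\<close>. If \<open>2 * size v\<close> exceeds
  \<open>corank y\<close>, truncation leaves no \<open>m\<close>.\<close>

abbreviation extensions :: "'a \<Rightarrow> ('a \<times> 'a multiset \<times> nat) set" where
  "extensions x \<equiv> (SIGMA y:above x. SIGMA v:Collect (primitive y).
     {1..min (\<rho> x y - 1) (corank y - 2 * size v)})"

lemma primitive_rec:
  "Collect (primitive x) = insert {#} ((\<lambda>(y, v, m). v + replicate_mset m y) ` extensions x)"
proof (intro equalityI subsetI)
  fix u assume "u \<in> Collect (primitive x)"
  then have "primitive x u" by simp
  then show "u \<in> insert {#} ((\<lambda>(y, v, m). v + replicate_mset m y) ` extensions x)"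
  proof cases
    case (add y v m)
    then have "(y, v, m) \<in> extensions x" by auto
    then show ?thesis using add by (force simp del: mem_Sigma_iff)
  qed simp
qed (auto intro!: primitive.intros)

text \<open>The smallest support element gives back \<open>y\<close>, its multiplicity
  \<open>m\<close>, and the rest \<open>v\<close>.\<close>

lemma inj_on_extensions: "inj_on (\<lambda>(y, v, m). v + replicate_mset m y) (extensions x)"
proof (rule inj_onI)
  fix p p' assume p: "p \<in> extensions x" "p' \<in> extensions x"
    and "(case p of (y, v, m) \<Rightarrow> v + replicate_mset m y) = (case p' of (y, v, m) \<Rightarrow> v + replicate_mset m y)"
  then obtain y v m y' v' m'
    where p_eq: "p = (y, v, m)" "p' = (y', v', m')"
      and eq: "v + replicate_mset m y = v' + replicate_mset m' y'"
    by (cases p, cases p') auto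
  have v: "primitive y v" "primitive y' v'" and m: "m > 0" "m' > 0"
    using p by (auto simp: p_eq)
  have "y \<in># v + replicate_mset m y" "y' \<in># v' + replicate_mset m' y'"
    using m by simp_all
  then have "y \<in># v' + replicate_mset m' y'" "y' \<in># v + replicate_mset m y"
    using eq by metis+
  then have "y = y' \<or> y \<in> above y' \<and> y' \<in> above y"
    using primitive_above[OF v(1)] primitive_above[OF v(2)] by (auto split: if_splits)
  then have y: "y' = y"
    using above_trans above_irrefl by blast
  have "y \<notin># v" "y \<notin># v'"
    using v y primitive_above above_irrefl by blast+
  then have "m = m'"
    using arg_cong[OF eq, of "\<lambda>u. count u y"] y by (simp add: not_in_iff)
  then show "p = p'"
    using eq y by (simp add: p_eq)
qed

lemma finite_primitive: "x \<in> P \<Longrightarrow> finite (Collect (primitive x))"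
proof (induction "corank x" arbitrary: x rule: less_induct)
  case less
  have "finite (Collect (primitive y))" if "y \<in> above x" for y
    using that less corank_above[of x y] rank_pos[of x y] above_P by auto
  then show ?case
    unfolding primitive_rec[of x] by (intro finite.insertI finite_imageI finite_SigmaI) auto
qed

section \<open>Expansion of the Chow polynomial over primitive monomials\<close>

lemma sum_primitive:
  fixes f :: "nat \<Rightarrow> 'b::comm_monoid_add"
  assumes "x \<in> P"
  shows "(\<Sum>u | primitive x u. f (size u)) = f 0 +
    (\<Sum>y\<in>above x. \<Sum>v | primitive y v.
       \<Sum>m = 1..min (\<rho> x y - 1) (corank y - 2 * size v). f (size v + m))"
proof -
  have fin: "finite (Collect (primitive y))" if "y \<in> above x" for y
    using that above_P finite_primitive by blast
  then have "finite (extensions x)"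
    by (intro finite_SigmaI) auto
  then have "(\<Sum>u | primitive x u. f (size u))
      = f 0 + (\<Sum>u\<in>(\<lambda>(y, v, m). v + replicate_mset m y) ` extensions x. f (size u))"
    unfolding primitive_rec[of x] by (subst sum.insert) auto
  also have "(\<Sum>u\<in>(\<lambda>(y, v, m). v + replicate_mset m y) ` extensions x. f (size u))
      = (\<Sum>(y, v, m)\<in>extensions x. f (size v + m))"
    by (subst sum.reindex[OF inj_on_extensions]) (auto intro!: sum.cong)
  also have "\<dots> = (\<Sum>y\<in>above x. \<Sum>(v, m)\<in>(SIGMA v:Collect (primitive y).
       {1..min (\<rho> x y - 1) (corank y - 2 * size v)}). f (size v + m))"
    using fin by (subst sum.Sigma) auto
  also have "\<dots> = (\<Sum>y\<in>above x. \<Sum>v | primitive y v.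
       \<Sum>m = 1..min (\<rho> x y - 1) (corank y - 2 * size v). f (size v + m))"
    using fin by (intro sum.cong refl, subst sum.Sigma) auto
  finally show ?thesis .
qed

text \<open>The top element is excluded because \<open>upper_chow hat1 = 1\<close>, whereas the sum vanishes there.\<close>

lemma upper_chow_eq_sum_primitive:
  assumes "x \<in> P" "x \<noteq> hat1"
  shows "upper_chow x =
    (\<Sum>u | primitive x u. monom 1 1 ^ size u * geom_sum (monom 1 1) (corank x - 2 * size u))"
  using assms
proof (induction "corank x" arbitrary: x rule: less_induct)
  case less
  let ?X = "monom 1 1 :: int poly"
  \<comment> \<open>\<open>f d\<close> is the symmetric string of a monomial of degree
    \<open>d\<close>; \<open>g y\<close> collects the strings of the monomials with smallest support
    element \<open>y\<close>.\<close>
  define f where "f d = ?X ^ d * geom_sum ?X (corank x - 2 * d)" for d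
  define g where "g y = (\<Sum>v | primitive y v.
      \<Sum>m = 1..min (\<rho> x y - 1) (corank y - 2 * size v). f (size v + m))" for y
  have g: "chow_factor (\<rho> x y) * upper_chow y = g y" if y: "y \<in> above x - {hat1}" for y
  proof -
    have k: "corank x = \<rho> x y + corank y" "\<rho> x y > 0"
      using y less.prems corank_above rank_pos by auto
    have "chow_factor (\<rho> x y) * (?X ^ size v * geom_sum ?X (corank y - 2 * size v))
        = (\<Sum>m = 1..min (\<rho> x y - 1) (corank y - 2 * size v). f (size v + m))" for v :: "'a multiset"
    proof -
      let ?a = "\<rho> x y - 1" and ?b = "corank y - 2 * size v"
      have "chow_factor (\<rho> x y) * (?X ^ size v * geom_sum ?X ?b)
          = ?X ^ Suc (size v) * (geom_sum ?X ?a * geom_sum ?X ?b)"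
        by (simp add: chow_factor_eq mult_ac)
      also have "\<dots> = (\<Sum>j<min ?a ?b. ?X ^ Suc (size v) * (?X ^ j * geom_sum ?X (?a + ?b - 1 - 2 * j)))"
        by (simp only: geom_sum_mult sum_distrib_left)
      also have "\<dots> = (\<Sum>j<min ?a ?b. f (size v + Suc j))"
      proof (rule sum.cong[OF refl])
        fix j assume "j \<in> {..<min ?a ?b}"
        \<comment> \<open>The summand \<open>j\<close> of the product rule corresponds to the
          exponent \<open>m = j + 1\<close> of \<open>y\<close>.\<close>
        then have "?a + ?b - 1 - 2 * j = corank x - 2 * (size v + Suc j)"
          using k by auto
        then show "?X ^ Suc (size v) * (?X ^ j * geom_sum ?X (?a + ?b - 1 - 2 * j)) = f (size v + Suc j)"
          by (simp add: f_def power_add mult_ac)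
      qed
      also have "\<dots> = (\<Sum>m = 1..min ?a ?b. f (size v + m))"
        by (simp add: sum.atLeast1_atMost_eq)
      finally show ?thesis .
    qed
    moreover have "upper_chow y =
        (\<Sum>v | primitive y v. ?X ^ size v * geom_sum ?X (corank y - 2 * size v))"
      using less k y above_P by auto
    ultimately show ?thesis
      by (simp add: g_def sum_distrib_left)
  qed
  have top: "hat1 \<in> above x"
    using less.prems hat1_above by blast
  have "upper_chow hat1 = 1"
    using upper_chow_rec[OF hat1_P] above_hat1 by simp
  moreover have "g hat1 = 0"
    by (simp add: g_def)
  \<comment> \<open>The chain \<open>[x]\<close> and the chain \<open>[x, hat1]\<close> together
    yield the string of the monomial 1; \<open>hat1\<close> divides no primitive monomial.\<close>
  moreover have "1 + chow_factor (corank x) = f 0"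
    using geom_sum_Suc_shift[of ?X "corank x - 1"] rank_pos[OF less.prems(1) top]
    by (simp add: f_def chow_factor_eq)
  ultimately have "upper_chow x = f 0 + (\<Sum>y\<in>above x. g y)"
    using g upper_chow_rec[OF less.prems(1)] by (simp add: sum.remove[OF _ top] algebra_simps)
  also have "\<dots> = (\<Sum>u | primitive x u. f (size u))"
    using sum_primitive[OF less.prems(1), of f] by (simp add: g_def)
  finally show ?case by (simp add: f_def)
qed

text \<open>The string of a monomial of degree \<open>d\<close> covers the positions from
  \<open>d\<close> to \<open>corank x - 1 - d\<close>. At \<open>hat1\<close> the truncated
  \<open>corank x - 1\<close> is 0, and the formula still gives the polynomial 1.\<close>

lemma coeff_upper_chow:
  assumes "x \<in> P"
  shows "coeff (upper_chow x) i =
    int (card {u \<in> Collect (primitive x). size u \<le> i \<and> i + size u \<le> corank x - 1})"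
proof (cases "x = hat1")
  case True
  then have M: "Collect (primitive x) = {{#}}"
    using primitive_rec[of x] by (simp add: above_hat1)
  have "{u \<in> {{#}}. size u \<le> i \<and> i + size u \<le> corank x - 1}
      = (if i = 0 then {{#} :: 'a multiset} else {})"
    using True by auto
  moreover have "upper_chow x = 1"
    using True upper_chow_rec[OF assms] above_hat1 by simp
  ultimately show ?thesis
    unfolding M by (simp only: coeff_1) simp
next
  case False
  then have "corank x > 0"
    using corank_eq_0_iff[OF assms] by simp
  have "coeff (upper_chow x) i =
      (\<Sum>u | primitive x u. if size u \<le> i \<and> i < size u + (corank x - 2 * size u) then 1 else 0)"
    by (simp only: upper_chow_eq_sum_primitive[OF assms False] coeff_sum coeff_power_mult_geom_sum)
  \<comment> \<open>Where \<open>corank x - 2 * size u\<close> truncates a negative value, both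
    conditions fail because of \<open>size u \<le> i\<close>.\<close>
  also have "\<dots> = (\<Sum>u | primitive x u. if size u \<le> i \<and> i + size u \<le> corank x - 1 then 1 else 0)"
    using \<open>corank x > 0\<close> by (intro sum.cong if_cong refl) auto
  also have "\<dots> = int (card {u \<in> Collect (primitive x). size u \<le> i \<and> i + size u \<le> corank x - 1})"
    using finite_primitive[OF assms] by (simp add: sum.If_cases Int_def)
  finally show ?thesis .
qed

end

theorem theorem1p1:
  fixes P :: "'a set" and r :: "'a rel" and \<rho> :: "'a \<Rightarrow> 'a \<Rightarrow> nat"
    and hat0 hat1 :: 'a and n :: nat
  assumes "finite P"
    and "partial_order_on P r"
    and "least_of P r hat0"
    and "greatest_of P r hat1"
    and "weak_rank_function P r \<rho>"
    and "\<rho> hat0 hat1 = n"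
  shows "degree (chow_poly P r \<rho> hat0) = n - 1 \<and>
         SI_sequence (coeffs (chow_poly P r \<rho> hat0))"
proof -
  interpret weakly_ranked_poset P r \<rho> hat0 hat1
    using assms by unfold_locales
  show ?thesis
  proof (rule SI_sequence_coeffsI)
    show "finite (Collect (primitive hat0))"
      by (rule finite_primitive[OF hat0_P])
    show "{#} \<in> Collect (primitive hat0)"
      by (simp add: primitive.empty)
    show "v \<in> Collect (primitive hat0)" if "u \<in> Collect (primitive hat0)" "v \<subseteq># u" for u v
      using that primitive_subset hat0_P by blast
    show "2 * size u \<le> n - 1" if "u \<in> Collect (primitive hat0)" for u
      using that primitive_size hat0_P assms(6) by blast
    show "coeff (chow_poly P r \<rho> hat0) i =
        int (card {u \<in> Collect (primitive hat0). size u \<le> i \<and> i + size u \<le> n - 1})" for i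
      using coeff_upper_chow[OF hat0_P] assms(6) by (simp add: upper_chow_hat0)
  qed
qed

end
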